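(* Let $q\ge 2$ be an integer and let $\Pi_q$ be any projective plane (not necessarily Desarguesian) of order $q$; no further assumption on the size of $q$ is made. Let $s(2,q)$ denote the smallest size of a saturating set in $\Pi_q$. Then \[ s(2,q)\leq \sqrt{(q+1)\left(3\ln q+\ln\ln q +\ln\tfrac{3}{4}\right)}+\sqrt{\frac{q}{3\ln q}}+3 . \]
   Context: A point set $\mathcal{S}$ in a projective plane $\Pi_q$ is called saturating if every point of $\Pi_q\setminus\mathcal{S}$ lies on a line containing two points of $\mathcal{S}$ (i.e. is collinear with two points of $\mathcal{S}$). Here $\ln$ is the natural logarithm. *)

theory Defs
  imports Complex_Main
begin

text \<open>A projective plane with point set \<open>P\<close> and line set \<open>L\<close>; a line is identified
  with the set of points incident with it.\<close>

locale projective_plane =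
  fixes P :: "'a set" and L :: "'a set set"
  assumes line_subset: "l \<in> L \<Longrightarrow> l \<subseteq> P"
    and unique_line: "x \<in> P \<Longrightarrow> y \<in> P \<Longrightarrow> x \<noteq> y \<Longrightarrow> \<exists>!l. l \<in> L \<and> x \<in> l \<and> y \<in> l"
    and unique_point: "l \<in> L \<Longrightarrow> m \<in> L \<Longrightarrow> l \<noteq> m \<Longrightarrow> \<exists>!x. x \<in> P \<and> x \<in> l \<and> x \<in> m"
    and quadrangle: "\<exists>Q. Q \<subseteq> P \<and> card Q = 4 \<and> (\<forall>l\<in>L. card (Q \<inter> l) \<le> 2)"

locale projective_plane_of_order = projective_plane P L
  for P :: "'a set" and L :: "'a set set" +
  fixes q :: nat
  assumes card_line: "l \<in> L \<Longrightarrow> card l = q + 1"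

definition saturating :: "'a set \<Rightarrow> 'a set set \<Rightarrow> 'a set \<Rightarrow> bool" where
  "saturating P L S \<longleftrightarrow> S \<subseteq> P \<and>
    (\<forall>p \<in> P - S. \<exists>l\<in>L. p \<in> l \<and> (\<exists>x\<in>S. \<exists>y\<in>S. x \<noteq> y \<and> x \<in> l \<and> y \<in> l))"

text \<open>The requirement \<open>finite S\<close> only guards against \<open>card\<close> being \<open>0\<close> on infinite sets;
  a plane of finite order has finitely many points, and its whole point set is saturating, so
  the minimum exists.\<close>

definition smallest_saturating_size :: "'a set \<Rightarrow> 'a set set \<Rightarrow> nat" where
  "smallest_saturating_size P L = (LEAST n. \<exists>S. saturating P L S \<and> finite S \<and> card S = n)"

end

theory Submission
  imports Defs
begin

text \<open>
  Build the set greedily. If \<open>S\<close> has \<open>w\<close> points and \<open>Q\<close> lies on no secant of \<open>S\<close>, then the \<open>w\<close> lines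
  joining \<open>Q\<close> to \<open>S\<close> are distinct, so \<open>w (q - 1) + 1\<close> of the \<open>q\<^sup>2 + q + 1 - w\<close> points outside \<open>S\<close>
  cover \<open>Q\<close> when added to \<open>S\<close>. Averaging, some point multiplies the number of uncovered points by
  at most \<open>1 - w / (q + 2)\<close>. Starting from two points, which leave \<open>q\<^sup>2\<close> points uncovered, at most
  \<open>q\<^sup>2 exp (- (w - 2) (w + 1) / (2 (q + 2)))\<close> points remain uncovered by \<open>w\<close> points. The remaining ones
  are covered two at a time: for \<open>P1, P2 \<in> S\<close>, the common point of the lines \<open>P1 Q1\<close> and \<open>P2 Q2\<close>
  covers both \<open>Q1\<close> and \<open>Q2\<close>. With \<open>X\<close> the first square root of the bound, \<open>w = \<lceil>X + 1\<rceil>\<close>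
  works for \<open>q \<ge> 13\<close>; for \<open>q \<le> 12\<close> a line and one further point already meet the bound.
\<close>

section \<open>Lines, uncovered points, and covering them in pairs\<close>

context projective_plane
begin

definition join :: "'a \<Rightarrow> 'a \<Rightarrow> 'a set" where
  "join x y = (THE l. l \<in> L \<and> x \<in> l \<and> y \<in> l)"

lemma join:
  assumes "x \<in> P" "y \<in> P" "x \<noteq> y"
  shows "join x y \<in> L" "x \<in> join x y" "y \<in> join x y"
  using theI'[OF unique_line[OF assms]] unfolding join_def by auto

lemma line_eqI:
  assumes "l \<in> L" "m \<in> L" "x \<noteq> y" "x \<in> l" "y \<in> l" "x \<in> m" "y \<in> m"
  shows "l = m"
  using assms unique_line[of x y] line_subset by blast

lemma join_eq:
  assumes "l \<in> L" "x \<in> l" "y \<in> l" "x \<noteq> y"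
  shows "join x y = l"
  using line_eqI[of "join x y" l x y] join[of x y] line_subset[OF assms(1)] assms by blast

lemma lines_meet:
  assumes "l \<in> L" "m \<in> L" "l \<noteq> m"
  obtains x where "x \<in> P" "x \<in> l" "x \<in> m"
  using unique_point[OF assms] by blast

text \<open>A line holds at most two of the four quadrangle points, so the join of two of them
  misses another.\<close>

lemma obtain_line_and_point:
  obtains l p where "l \<in> L" "p \<in> P" "p \<notin> l"
proof -
  obtain Q where Q: "Q \<subseteq> P" "card Q = 4" "\<forall>l\<in>L. card (Q \<inter> l) \<le> 2"
    using quadrangle by blast
  have fin: "finite Q" using Q(2) by (simp add: card_ge_0_finite)
  obtain x y where xy: "x \<in> Q" "y \<in> Q" "x \<noteq> y"
    using Q(2) card_le_Suc0_iff_eq[OF fin] by auto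
  then have l: "join x y \<in> L" using Q(1) join(1)[of x y] by blast
  have "\<not> Q \<subseteq> join x y"
  proof
    assume "Q \<subseteq> join x y"
    then have "Q \<inter> join x y = Q" by blast
    then show False using Q(2) bspec[OF Q(3) l] by simp
  qed
  then show thesis using that l Q(1) by blast
qed

definition uncovered :: "'a set \<Rightarrow> 'a set" where
  "uncovered S = {p \<in> P - S.
    \<not> (\<exists>l\<in>L. p \<in> l \<and> (\<exists>x\<in>S. \<exists>y\<in>S. x \<noteq> y \<and> x \<in> l \<and> y \<in> l))}"

lemma uncovered_subset: "uncovered S \<subseteq> P" "uncovered S \<inter> S = {}"
  unfolding uncovered_def by auto

text \<open>This is the form in which being uncovered is used: a line through \<open>p\<close> meets
  \<open>S\<close> at most once, so joins of \<open>p\<close> to different points of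
  \<open>S\<close> differ.\<close>

lemma uncoveredD:
  assumes "p \<in> uncovered S" "l \<in> L" "p \<in> l" "x \<in> S" "y \<in> S" "x \<in> l" "y \<in> l"
  shows "x = y"
  using assms unfolding uncovered_def by blast

lemma saturating_iff_uncovered: "saturating P L S \<longleftrightarrow> S \<subseteq> P \<and> uncovered S = {}"
  unfolding saturating_def uncovered_def by blast

lemma uncovered_mono: "S \<subseteq> T \<Longrightarrow> uncovered T \<subseteq> uncovered S"
  unfolding uncovered_def by blast

text \<open>Adding \<open>A\<close> turns \<open>l\<close> into a secant. The case
  \<open>A = Q\<close> is included: then \<open>Q\<close> belongs to the new set.\<close>

lemma not_uncovered_insert:
  assumes "l \<in> L" "Q \<in> l" "x \<in> l" "A \<in> l" "x \<in> S" "A \<noteq> x"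
  shows "Q \<notin> uncovered (insert A S)"
  using assms unfolding uncovered_def by blast

lemma cover_two_points:
  assumes S: "S \<subseteq> P" "P1 \<in> S" "P2 \<in> S" "P1 \<noteq> P2"
    and Q: "Q1 \<in> uncovered S" "Q2 \<in> uncovered S"
  obtains A where "A \<in> P" "Q1 \<notin> uncovered (insert A S)" "Q2 \<notin> uncovered (insert A S)"
proof -
  have 1: "join P1 Q1 \<in> L" "P1 \<in> join P1 Q1" "Q1 \<in> join P1 Q1"
    using join[of P1 Q1] S Q uncovered_subset[of S] by blast+
  have 2: "join P2 Q2 \<in> L" "P2 \<in> join P2 Q2" "Q2 \<in> join P2 Q2"
    using join[of P2 Q2] S Q uncovered_subset[of S] by blast+
  \<comment> \<open>As \<open>Q1\<close> and \<open>Q2\<close> are uncovered, each join meets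
    \<open>S\<close> in one point only. Hence the two joins differ, and their common point
    \<open>A\<close> is neither \<open>P1\<close> nor \<open>P2\<close>.\<close>
  have "P2 \<notin> join P1 Q1" "P1 \<notin> join P2 Q2"
    using uncoveredD[OF Q(1) 1(1)] uncoveredD[OF Q(2) 2(1)] 1 2 S by blast+
  moreover from this obtain A where "A \<in> P" "A \<in> join P1 Q1" "A \<in> join P2 Q2"
    using lines_meet[OF 1(1) 2(1)] 2(2) by metis
  ultimately show thesis
    using that not_uncovered_insert[OF 1(1,3,2)] not_uncovered_insert[OF 2(1,3,2)] S(2,3) by metis
qed

text \<open>Uncovered points are removed two at a time, and a last single one is added to the set
  itself; this is the rounding up in \<open>div\<close>. The points \<open>P1\<close>,
  \<open>P2\<close> stay in the growing set and serve at every round.\<close>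

lemma ex_saturating_superset:
  assumes "finite P" "S \<subseteq> P" "P1 \<in> S" "P2 \<in> S" "P1 \<noteq> P2"
  shows "\<exists>T. saturating P L T \<and> card T \<le> card S + (card (uncovered S) + 1) div 2"
  using assms(2-4)
proof (induction "card (uncovered S)" arbitrary: S rule: less_induct)
  case less
  have fin: "finite (uncovered S)" for S
    using assms(1) uncovered_subset(1) finite_subset by blast
  consider "uncovered S = {}" | Q where "uncovered S = {Q}"
    | Q1 Q2 where "Q1 \<in> uncovered S" "Q2 \<in> uncovered S" "Q1 \<noteq> Q2" by blast
  then show ?case
  proof cases
    case 1
    then have "saturating P L S" using less.prems by (simp add: saturating_iff_uncovered)
    then show ?thesis by (intro exI[of _ S]) simp
  next
    case (2 Q)
    have "uncovered (insert Q S) = {}"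
      using 2 uncovered_mono[of S "insert Q S"] uncovered_subset(2)[of "insert Q S"] by blast
    moreover have "insert Q S \<subseteq> P" using less.prems(1) 2 uncovered_subset(1)[of S] by blast
    ultimately have "saturating P L (insert Q S)" by (simp add: saturating_iff_uncovered)
    moreover have "card (insert Q S) \<le> card S + 1"
      using less.prems(1) assms(1) finite_subset[of S P] by (simp add: card_insert_if)
    ultimately show ?thesis using 2 by (intro exI[of _ "insert Q S"]) simp
  next
    case (3 Q1 Q2)
    obtain A where A: "A \<in> P" "Q1 \<notin> uncovered (insert A S)" "Q2 \<notin> uncovered (insert A S)"
      using cover_two_points[OF less.prems assms(5) 3(1,2)] .
    then have "uncovered (insert A S) \<subseteq> uncovered S - {Q1, Q2}"
      using uncovered_mono[of S "insert A S"] by blast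
    then have "card (uncovered (insert A S)) \<le> card (uncovered S - {Q1, Q2})"
      using fin by (intro card_mono) auto
    also have "\<dots> = card (uncovered S) - card {Q1, Q2}" using 3 by (intro card_Diff_subset) auto
    also have "\<dots> = card (uncovered S) - 2" using 3(3) by simp
    finally have le: "card (uncovered (insert A S)) \<le> card (uncovered S) - 2" .
    \<comment> \<open>With at least two uncovered points the truncated \<open>- 2\<close> is a true
      subtraction and the induction measure drops.\<close>
    have "card {Q1, Q2} \<le> card (uncovered S)"
      using 3 fin by (intro card_mono) auto
    then have two: "2 \<le> card (uncovered S)" using 3(3) by simp
    obtain T where "saturating P L T"
      "card T \<le> card (insert A S) + (card (uncovered (insert A S)) + 1) div 2"
    proof -
      have "card (uncovered (insert A S)) < card (uncovered S)" using le two by linarith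
      then show thesis using that less.hyps[of "insert A S"] less.prems A(1) by blast
    qed
    moreover have "card (insert A S) \<le> card S + 1"
      using less.prems(1) assms(1) finite_subset[of S P] by (simp add: card_insert_if)
    ultimately have "card T \<le> card S + (card (uncovered S) + 1) div 2" using le two by linarith
    then show ?thesis using \<open>saturating P L T\<close> by blast
  qed
qed

end

section \<open>Counting points in a plane of order \<open>q\<close>\<close>

context projective_plane_of_order
begin

lemma finite_line: "l \<in> L \<Longrightarrow> finite l"
  using card_line card.infinite by fastforce

text \<open>Project from a point \<open>p\<close> off a line \<open>l\<close>: the
  \<open>q + 1\<close> joins of \<open>p\<close> to points of \<open>l\<close> cover the plane, and
  each has \<open>q\<close> points besides \<open>p\<close>. Two of them sharing such a point would
  coincide with \<open>l\<close>, which misses \<open>p\<close>.\<close>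

lemma finite_card_points: "finite P" "card P = q\<^sup>2 + q + 1"
proof -
  obtain l p where lp: "l \<in> L" "p \<in> P" "p \<notin> l" using obtain_line_and_point .
  have lP: "l \<subseteq> P" using line_subset lp(1) .
  have j: "join p x \<in> L" "p \<in> join p x" "x \<in> join p x" if "x \<in> l" for x
    using join[of p x] lp lP that by blast+
  have Peq: "P = insert p (\<Union>x\<in>l. join p x - {p})"
  proof (intro equalityI subsetI)
    fix y assume y: "y \<in> P"
    show "y \<in> insert p (\<Union>x\<in>l. join p x - {p})"
    proof (cases "y = p")
      case False
      then have py: "join p y \<in> L" "p \<in> join p y" "y \<in> join p y" using join lp(2) y by auto
      then obtain x where x: "x \<in> l" "x \<in> join p y" using lines_meet lp by metis
      then have "join p x = join p y" using join_eq py lp(3) by metis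
      then show ?thesis using x py False by auto
    qed simp
  qed (use lp j line_subset in blast)
  have dj: "(join p x - {p}) \<inter> (join p y - {p}) = {}" if "x \<in> l" "y \<in> l" "x \<noteq> y" for x y
  proof (rule ccontr)
    assume "\<not> ?thesis"
    then have "join p x = join p y" using that j line_eqI by blast
    then have "join p x = l" using that j line_eqI lp(1) by metis
    then show False using j that lp(3) by blast
  qed
  have fin: "finite l" "\<And>x. x \<in> l \<Longrightarrow> finite (join p x - {p})"
    using finite_line lp(1) j by auto
  show "finite P" using fin by (subst Peq) simp
  have "card (\<Union>x\<in>l. join p x - {p}) = (\<Sum>x\<in>l. card (join p x - {p}))"
    using fin dj by (intro card_UN_disjoint) auto
  also have "\<dots> = (\<Sum>x\<in>l. q)" using j card_line finite_line by (intro sum.cong) auto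
  also have "\<dots> = (q + 1) * q" using card_line lp(1) by simp
  finally have "card (\<Union>x\<in>l. join p x - {p}) = (q + 1) * q" .
  then have "card (insert p (\<Union>x\<in>l. join p x - {p})) = (q + 1) * q + 1"
    using fin by (subst card_insert_disjoint) auto
  then show "card P = q\<^sup>2 + q + 1"
    by (subst Peq) (simp add: power2_eq_square algebra_simps)
qed

text \<open>Each join of \<open>Q\<close> to a point \<open>x\<close> of \<open>S\<close>
  contributes its \<open>q - 1\<close> points other than \<open>Q\<close> and \<open>x\<close>; the
  extra 1 is \<open>Q\<close> itself.\<close>

lemma card_covering_points:
  assumes S: "S \<subseteq> P" and Q: "Q \<in> uncovered S"
  shows "card S * (q - 1) + 1 \<le> card {A \<in> P - S. Q \<notin> uncovered (insert A S)}"
proof -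
  let ?M = "\<lambda>x. join Q x - {Q, x}"
  have QP: "Q \<in> P" "Q \<notin> S" using Q uncovered_subset by blast+
  have j: "join Q x \<in> L" "Q \<in> join Q x" "x \<in> join Q x" if "x \<in> S" for x
    using join[of Q x] QP S that by blast+
  have fin: "finite S" "\<And>x. x \<in> S \<Longrightarrow> finite (?M x)"
    using finite_card_points(1) S finite_subset finite_line j by auto
  \<comment> \<open>This gives both that the joins are distinct, so they share only
    \<open>Q\<close>, and that their remaining points lie outside \<open>S\<close>.\<close>
  have only: "y = x" if "x \<in> S" "y \<in> S" "y \<in> join Q x" for x y
    using uncoveredD[OF Q j(1,2)] j that by blast
  have dj: "?M x \<inter> ?M y = {}" if "x \<in> S" "y \<in> S" "x \<noteq> y" for x y
  proof (rule ccontr)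
    assume "\<not> ?thesis"
    then have "join Q x = join Q y" using that j line_eqI by blast
    then show False using only that j by blast
  qed
  have "card (\<Union>x\<in>S. ?M x) = (\<Sum>x\<in>S. card (?M x))"
    using fin dj by (intro card_UN_disjoint) auto
  also have "\<dots> = (\<Sum>x\<in>S. q - 1)"
  proof (intro sum.cong refl)
    fix x assume x: "x \<in> S"
    then have "Q \<noteq> x" using QP by blast
    then show "card (?M x) = q - 1"
      using j[OF x] card_line by (subst card_Diff_subset) auto
  qed
  finally have "card (insert Q (\<Union>x\<in>S. ?M x)) = card S * (q - 1) + 1"
    using fin by (subst card_insert_disjoint) auto
  moreover have "insert Q (\<Union>x\<in>S. ?M x) \<subseteq> {A \<in> P - S. Q \<notin> uncovered (insert A S)}"
  proof
    fix A assume "A \<in> insert Q (\<Union>x\<in>S. ?M x)"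
    then consider "A = Q" | x where "x \<in> S" "A \<in> join Q x" "A \<noteq> x" by blast
    then show "A \<in> {A \<in> P - S. Q \<notin> uncovered (insert A S)}"
    proof cases
      case 1
      then show ?thesis using QP uncovered_subset(2)[of "insert A S"] by blast
    next
      case (2 x)
      then have "A \<in> P - S" using j line_subset only by blast
      then show ?thesis using not_uncovered_insert[OF j(1-3)] 2 by blast
    qed
  qed
  moreover have "finite {A \<in> P - S. Q \<notin> uncovered (insert A S)}"
    using finite_card_points(1) by simp
  ultimately show ?thesis
    using card_mono[of "{A \<in> P - S. Q \<notin> uncovered (insert A S)}" "insert Q (\<Union>x\<in>S. ?M x)"]
    by linarith
qed

text \<open>The covering points all lie in \<open>P - S\<close>. The averaging below uses this to
  see that \<open>P - S\<close> is nonempty.\<close>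

lemma card_le_of_uncovered:
  assumes S: "S \<subseteq> P" and Q: "Q \<in> uncovered S"
  shows "card S * (q - 1) + 1 + card S \<le> q\<^sup>2 + q + 1"
proof -
  have "card {A \<in> P - S. Q \<notin> uncovered (insert A S)} \<le> card (P - S)"
    using finite_card_points(1) by (intro card_mono) auto
  also have "\<dots> = card P - card S"
    using S finite_card_points(1) finite_subset by (intro card_Diff_subset) auto
  finally show ?thesis
    using card_covering_points[OF assms] finite_card_points by linarith
qed

section \<open>The greedy construction\<close>

lemma ex_greedy_point:
  assumes q: "q \<ge> 2" and S: "S \<subseteq> P" "card S \<ge> 2" and U: "uncovered S \<noteq> {}"
  obtains A where "A \<in> P - S"
    "real (card (uncovered (insert A S))) \<le> real (card (uncovered S)) * (1 - card S / (q + 2))"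
proof -
  let ?U = "uncovered S" and ?N = "P - S" and ?w = "card S"
  let ?C = "\<lambda>A. ?U - uncovered (insert A S)"
  have finU: "finite ?U" using finite_card_points(1) uncovered_subset(1) finite_subset by blast
  have finN: "finite ?N" using finite_card_points(1) by blast
  obtain Q where Q: "Q \<in> ?U" using U by blast
  have cN: "card ?N + ?w = q\<^sup>2 + q + 1"
    using S finite_card_points finite_subset card_Diff_subset card_mono
    by (metis le_add_diff_inverse2)
  have pos: "card ?N > 0" using card_le_of_uncovered[OF S(1) Q] cN by linarith
  \<comment> \<open>Double count the pairs of an uncovered \<open>Q\<close> and a candidate
    \<open>A\<close> that covers it.\<close>
  have "card ?U * (?w * (q - 1) + 1) = (\<Sum>Q\<in>?U. ?w * (q - 1) + 1)" by simp
  also have "\<dots> \<le> (\<Sum>Q\<in>?U. card {A \<in> ?N. Q \<notin> uncovered (insert A S)})"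
    by (intro sum_mono card_covering_points S)
  also have "\<dots> = (\<Sum>A\<in>?N. card {Q \<in> ?U. Q \<notin> uncovered (insert A S)})"
    using finU finN by (rule sum_multicount_gen) auto
  also have "\<dots> = (\<Sum>A\<in>?N. card (?C A))"
    by (intro sum.cong refl arg_cong[where f = card]) auto
  finally have sum: "card ?U * (?w * (q - 1) + 1) \<le> (\<Sum>A\<in>?N. card (?C A))" .
  \<comment> \<open>Some candidate reaches the average; the inequality is multiplied out to stay in
    the naturals.\<close>
  have "\<exists>A\<in>?N. card ?U * (?w * (q - 1) + 1) \<le> card ?N * card (?C A)"
  proof (rule ccontr)
    assume "\<not> ?thesis"
    then have "(\<Sum>A\<in>?N. card ?N * card (?C A)) < (\<Sum>A\<in>?N. card ?U * (?w * (q - 1) + 1))"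
      using finN pos by (intro sum_strict_mono) (auto simp: not_le card_gt_0_iff)
    then have "card ?N * (\<Sum>A\<in>?N. card (?C A)) < card ?N * (card ?U * (?w * (q - 1) + 1))"
      by (simp add: sum_distrib_left)
    then show False using sum pos by simp
  qed
  then obtain A where A: "A \<in> ?N" "card ?U * (?w * (q - 1) + 1) \<le> card ?N * card (?C A)" by blast
  have sub: "uncovered (insert A S) \<subseteq> ?U" by (intro uncovered_mono) blast
  define u c n w where "u = real (card ?U)" and "c = real (card (?C A))"
    and "n = real (card ?N)" and "w = real ?w"
  have "c = u - real (card (uncovered (insert A S)))"
    unfolding c_def u_def using sub finU card_mono[OF finU sub] finite_subset[OF sub finU]
    by (simp add: card_Diff_subset of_nat_diff)
  moreover have "u * w / (q + 2) \<le> c"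
  proof -
    have w2: "w \<ge> 2" using S(2) by (simp add: w_def)
    have n: "n = real q ^ 2 + q + 1 - w"
      using arg_cong[OF cN, of real] by (simp add: n_def w_def)
    \<comment> \<open>The covered proportion \<open>(w * (q - 1) + 1) / n\<close> is weakened to
      \<open>w / (q + 2)\<close>, whose denominator is independent of \<open>w\<close>, so that the
      exponents can be summed.\<close>
    have "n * w \<le> (w * (q - 1) + 1) * (q + 2)"
    proof -
      have "(w * (real q - 1) + 1) * (real q + 2) - n * w = (w - 1) * (w - 2) + real q"
        unfolding n by (simp add: algebra_simps power2_eq_square)
      moreover have "(w - 1) * (w - 2) \<ge> 0" using w2 by simp
      ultimately have "n * w \<le> (w * (real q - 1) + 1) * (real q + 2)" using q by linarith
      then show ?thesis using q by (simp add: of_nat_diff add.commute)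
    qed
    then have "n * (u * w) \<le> u * (w * (q - 1) + 1) * (q + 2)"
      using mult_left_mono[of "n * w" _ u] by (simp add: u_def mult.assoc mult.left_commute)
    also have "\<dots> \<le> (n * c) * (q + 2)"
    proof -
      have "real (card ?U * (?w * (q - 1) + 1)) \<le> real (card ?N * card (?C A))"
        using A(2) of_nat_le_iff by blast
      then have "u * (w * (q - 1) + 1) \<le> n * c"
        unfolding u_def n_def c_def w_def of_nat_mult of_nat_add of_nat_1 .
      then show ?thesis by (intro mult_right_mono) simp_all
    qed
    finally have "n * (u * w) \<le> n * (c * (q + 2))" by (simp only: mult.assoc)
    moreover have "n > 0" using pos by (simp add: n_def)
    ultimately have "u * w \<le> c * (q + 2)" using mult_le_cancel_left_pos by blast
    then show ?thesis using pos_divide_le_eq[of "real (q + 2)"] by simp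
  qed
  ultimately have "real (card (uncovered (insert A S))) \<le> u - u * w / (q + 2)" by linarith
  also have "\<dots> = u * (1 - w / (q + 2))" by (simp add: right_diff_distrib)
  finally show thesis using that[OF A(1)] unfolding u_def w_def by blast
qed

text \<open>The numerator \<open>(w - 2) * (w + 1) / 2\<close> is the sum of the integers from 2 to
  \<open>w - 1\<close>, the set sizes before each greedy step. The first alternative records an
  early end of the process.\<close>

lemma ex_greedy_set:
  assumes q: "q \<ge> 2" and w: "w \<ge> 2"
  shows "\<exists>S \<subseteq> P. (saturating P L S \<and> card S \<le> w) \<or> (card S = w \<and>
    real (card (uncovered S)) \<le> real q ^ 2 * exp (- ((real w - 2) * (real w + 1)) / (2 * (real q + 2))))"
  using w
proof (induction w rule: dec_induct)
  case base
  obtain l p where lp: "l \<in> L" "p \<in> P" "p \<notin> l" using obtain_line_and_point .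
  have "card l \<ge> 2" using card_line lp(1) q by simp
  then obtain x y where xy: "x \<in> l" "y \<in> l" "x \<noteq> y"
    using card_le_Suc0_iff_eq[OF finite_line[OF lp(1)]] by force
  have lP: "l \<subseteq> P" using line_subset lp(1) .
  \<comment> \<open>The line through the two starting points is covered, which leaves at most
    \<open>q\<^sup>2\<close> points.\<close>
  have "uncovered {x, y} \<subseteq> P - l" unfolding uncovered_def using xy lp(1) by blast
  then have "card (uncovered {x, y}) \<le> card (P - l)"
    using finite_card_points(1) by (intro card_mono) auto
  also have "\<dots> = q\<^sup>2"
    using lP lp(1) finite_line card_line finite_card_points by (simp add: card_Diff_subset)
  finally have "real (card (uncovered {x, y})) \<le> real q ^ 2" by (metis of_nat_le_iff of_nat_power)
  then show ?case using xy lP by (intro exI[of _ "{x, y}"]) auto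
next
  case (step w)
  let ?e = "\<lambda>w::nat. exp (- ((real w - 2) * (real w + 1)) / (2 * (real q + 2)))"
  obtain S where S: "S \<subseteq> P" "(saturating P L S \<and> card S \<le> w) \<or> (card S = w \<and>
      real (card (uncovered S)) \<le> real q ^ 2 * ?e w)" using step.IH by blast
  show ?case
  proof (cases "uncovered S = {}")
    case True
    then show ?thesis using S saturating_iff_uncovered by (intro exI[of _ S]) auto
  next
    case False
    then have cS: "card S = w" and u: "real (card (uncovered S)) \<le> real q ^ 2 * ?e w"
      using S saturating_iff_uncovered by auto
    obtain A where A: "A \<in> P - S"
      "real (card (uncovered (insert A S))) \<le> real (card (uncovered S)) * (1 - w / (q + 2))"
      using ex_greedy_point[OF q S(1) _ False] cS step.hyps by auto
    note A(2)
    \<comment> \<open>By \<open>1 - t <= exp (- t)\<close> the product of factors becomes the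
      exponential of a sum.\<close>
    also have "\<dots> \<le> real (card (uncovered S)) * exp (- (w / (q + 2)))"
      using exp_ge_add_one_self[of "- (w / (q + 2))"] by (intro mult_left_mono) auto
    also have "\<dots> \<le> real q ^ 2 * ?e w * exp (- (w / (q + 2)))"
      using u by (intro mult_right_mono) auto
    also have "\<dots> = real q ^ 2 * ?e (Suc w)"
    proof -
      have "- ((real w - 2) * (real w + 1)) / (2 * (real q + 2)) + - (w / (q + 2))
        = - ((real (Suc w) - 2) * (real (Suc w) + 1)) / (2 * (real q + 2))"
        by (simp add: divide_simps) (simp add: algebra_simps)
      then show ?thesis by (simp only: exp_add[symmetric] mult.assoc)
    qed
    finally have "real (card (uncovered (insert A S))) \<le> real q ^ 2 * ?e (Suc w)" .
    moreover have "card (insert A S) = Suc w"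
      using A(1) S(1) cS finite_card_points(1) finite_subset by fastforce
    ultimately show ?thesis using A(1) S(1) by (intro exI[of _ "insert A S"]) auto
  qed
qed

section \<open>Upper bounds on the smallest size\<close>

lemma smallest_saturating_size_le:
  assumes "saturating P L S"
  shows "smallest_saturating_size P L \<le> card S"
proof -
  have "finite S"
    using assms finite_card_points(1) finite_subset[of S P] saturating_iff_uncovered[of S] by blast
  then show ?thesis
    unfolding smallest_saturating_size_def using assms by (intro Least_le exI[of _ S] conjI refl)
qed

lemma smallest_saturating_size_le_greedy:
  assumes q: "q \<ge> 2" and w: "w \<ge> 2"
  shows "real (smallest_saturating_size P L)
    \<le> w + (real q ^ 2 * exp (- ((real w - 2) * (real w + 1)) / (2 * (real q + 2))) + 1) / 2"
    (is "_ \<le> w + (?r + 1) / 2")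
proof -
  have r: "?r \<ge> 0" by simp
  obtain S where S: "S \<subseteq> P" "(saturating P L S \<and> card S \<le> w) \<or>
      (card S = w \<and> real (card (uncovered S)) \<le> ?r)" using ex_greedy_set[OF assms] by blast
  then show ?thesis
  proof (elim disjE conjE)
    assume "saturating P L S" "card S \<le> w"
    then have "smallest_saturating_size P L \<le> w" using smallest_saturating_size_le by fastforce
    then have "real (smallest_saturating_size P L) \<le> w" by simp
    then show ?thesis using r by argo
  next
    assume c: "card S = w" and u: "real (card (uncovered S)) \<le> ?r"
    obtain x y where "x \<in> S" "y \<in> S" "x \<noteq> y"
      using c w card_le_Suc0_iff_eq[of S] S(1) finite_card_points(1) finite_subset by force
    then obtain T where "saturating P L T" "card T \<le> w + (card (uncovered S) + 1) div 2"
      using ex_saturating_superset[OF finite_card_points(1) S(1)] c by blast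
    then have "smallest_saturating_size P L \<le> w + (card (uncovered S) + 1) div 2"
      using smallest_saturating_size_le by fastforce
    \<comment> \<open>Doubling removes the integer division before passing to the reals.\<close>
    then have "2 * smallest_saturating_size P L \<le> 2 * w + card (uncovered S) + 1" by linarith
    then have "real (2 * smallest_saturating_size P L) \<le> real (2 * w + card (uncovered S) + 1)"
      using of_nat_le_iff by blast
    then have "2 * real (smallest_saturating_size P L) \<le> 2 * real w + real (card (uncovered S)) + 1"
      by simp
    then show ?thesis using u by argo
  qed
qed

text \<open>A line \<open>l\<close> with a point \<open>p\<close> off it saturates: the join of
  \<open>p\<close> to any other point meets \<open>l\<close>, in a point different from
  \<open>p\<close>.\<close>

lemma smallest_saturating_size_le_line: "smallest_saturating_size P L \<le> q + 2"
proof -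
  obtain l p where lp: "l \<in> L" "p \<in> P" "p \<notin> l" using obtain_line_and_point .
  have lP: "l \<subseteq> P" using line_subset lp(1) .
  have "saturating P L (insert p l)"
    unfolding saturating_def
  proof (intro conjI ballI)
    show "insert p l \<subseteq> P" using lp lP by blast
    fix y assume y: "y \<in> P - insert p l"
    then have j: "join p y \<in> L" "p \<in> join p y" "y \<in> join p y" using join lp(2) by auto
    then obtain x where x: "x \<in> l" "x \<in> join p y" using lines_meet lp by metis
    moreover have "p \<noteq> x" using x lp(3) by blast
    ultimately show "\<exists>l'\<in>L. y \<in> l' \<and> (\<exists>u\<in>insert p l. \<exists>v\<in>insert p l. u \<noteq> v \<and> u \<in> l' \<and> v \<in> l')"
      using j by (intro bexI[of _ "join p y"] bexI[of _ p] bexI[of _ x] conjI) auto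
  qed
  moreover have "card (insert p l) = q + 2"
    using lp finite_line card_line by simp
  ultimately show ?thesis using smallest_saturating_size_le by metis
qed

end

section \<open>Numerical estimates\<close>

lemma ln_ge_of_pow_le:
  fixes x y :: real
  assumes "(1 + y / 32 + (y / 32)\<^sup>2) ^ 32 \<le> x" "0 \<le> y" "y \<le> 32"
  shows "y \<le> ln x"
proof -
  have "exp y = exp (y / 32) ^ 32" by (simp flip: exp_of_nat_mult)
  also have "\<dots> \<le> (1 + y / 32 + (y / 32)\<^sup>2) ^ 32"
    using assms exp_bound[of "y / 32"] by (intro power_mono) auto
  also note assms(1)
  finally have "exp y \<le> x" .
  then show ?thesis by (metis exp_gt_zero ln_exp ln_le_cancel_iff order_less_le_trans)
qed

text \<open>Here \<open>1 + t <= exp t\<close> at \<open>t = y / 64\<close>, where the lower bound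
  on \<open>ln\<close> used \<open>exp t <= 1 + t + t\<^sup>2\<close>. Both reduce bounds on
  \<open>ln\<close> of a numeral to rational arithmetic.\<close>

lemma ln_le_of_le_pow:
  fixes x y :: real
  assumes "x \<le> (1 + y / 64) ^ 64" "0 < x" "0 \<le> y"
  shows "ln x \<le> y"
proof -
  note assms(1)
  also have "(1 + y / 64) ^ 64 \<le> exp (y / 64) ^ 64" using assms(3) by (intro power_mono) auto
  also have "\<dots> = exp y" by (simp flip: exp_of_nat_mult)
  finally show ?thesis using assms(2) by (metis ln_exp ln_mono)
qed

lemma exponent_eq:
  fixes x :: real
  assumes "x \<ge> 2"
  shows "3 * ln x + ln (ln x) + ln (3 / 4) = 3 * ln x + ln (3 / 4 * ln x)"
  using assms using ln_mult_pos[of "3 / 4" "ln x"] by (simp del: times_divide_eq_left)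

text \<open>Together the two bounds give \<open>(Y + 2)\<^sup>2 <= (x + 1) * Y\<close>, the
  inequality needed for large orders.\<close>

lemma exponent_bounds:
  fixes x :: real
  assumes "x \<ge> 13"
  defines "Y \<equiv> 3 * ln x + ln (ln x) + ln (3 / 4)"
  shows "4 \<le> Y" "Y + 4 \<le> x"
proof -
  have "2 \<le> ln (13::real)"
        by (intro ln_ge_of_pow_le) (simp_all add: power2_eq_square power_divide)
  then have lo: "2 \<le> ln x" using assms(1) by (smt (verit) ln_mono)
  have Y: "Y = 3 * ln x + ln (3 / 4 * ln x)" unfolding Y_def using assms(1) by (intro exponent_eq) simp
  have "0 \<le> ln (3 / 4 * ln x)" using lo by simp
  then show "4 \<le> Y" using Y lo by linarith
  have "ln (3 / 4 * ln x) \<le> 3 / 4 * ln x - 1" using lo by (intro ln_le_minus_one) simp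
  then have Yle: "Y \<le> 15 / 4 * ln x - 1" using Y by linarith
  have "ln 13 \<le> (8 / 3 :: real)" by (intro ln_le_of_le_pow) (simp_all add: power_divide)
  \<comment> \<open>The tangent to \<open>ln\<close> at 13 makes the claim linear in
    \<open>x\<close>; with 8/3 in place of \<open>ln 13\<close> it is tight at
    \<open>x = 13\<close>.\<close>
  moreover have "ln x = ln 13 + ln (x / 13)" using assms(1) by (simp add: ln_div)
  moreover have "ln (x / 13) \<le> x / 13 - 1" using assms(1) by (intro ln_le_minus_one) simp
  ultimately show "Y + 4 \<le> x" using Yle assms(1) by linarith
qed

text \<open>Up to 8 the first root alone is at least \<open>q - 1\<close>. From 9 to 12 the second
  root is at least 1, so \<open>q - 2\<close> suffices for the first.\<close>

lemma bound_ge_line: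
  fixes q :: nat
  assumes "2 \<le> q" "q \<le> 12"
  shows "real q + 2 \<le> sqrt ((real q + 1) * (3 * ln (real q) + ln (ln (real q)) + ln (3 / 4)))
      + sqrt (real q / (3 * ln (real q))) + 3"
proof -
  define Y where "Y = 3 * ln (real q) + ln (3 / 4 * ln (real q))"
  have Yeq: "3 * ln (real q) + ln (ln (real q)) + ln (3 / 4) = Y"
    unfolding Y_def using assms by (intro exponent_eq) simp
  define T where "T = sqrt (real q / (3 * ln (real q)))"
  have T0: "T \<ge> 0" using assms by (simp add: T_def)
  have Ylow: "3 * c + ln (3 / 4 * c) \<le> Y" if "c \<le> ln (real q)" "0 < c" for c
    unfolding Y_def using that by (intro add_mono ln_mono) auto
  have "q \<in> {2..8} \<union> {9..12}" using assms by auto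
  then have "real q - 1 \<le> sqrt ((real q + 1) * Y) + T"
  proof
    assume "q \<in> {2..8}"
    then have "q = 2 \<or> q \<in> {3, 4} \<or> q \<in> {5, 6, 7} \<or> q = 8" by auto
    then have "(real q - 1)\<^sup>2 \<le> (real q + 1) * Y"
    proof (elim disjE)
      assume q: "q = 2"
      have "2 / 3 \<le> ln (2::real)"
        by (intro ln_ge_of_pow_le) (simp_all add: power2_eq_square power_divide)
      then have "3 * (2/3) + ln (3 / 4 * (2/3)) \<le> Y" using q by (intro Ylow) auto
      \<comment> \<open>Only here is the lower bound for the merged logarithm as small as
        \<open>- ln 2\<close>; \<open>ln 2 < 1\<close> still leaves \<open>Y\<close> above
        1.\<close>
      moreover have "ln (3 / 4 * (2/3) :: real) = - ln 2" by (simp add: ln_div)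
      ultimately show ?thesis using q ln_2_less_1 by simp
    next
      assume q: "q \<in> {3, 4}"
      have "1 \<le> ln (3::real)" using exp_le by (metis exp_gt_zero ln_exp ln_mono)
      moreover have "ln 3 \<le> ln (real q)" using q by (intro ln_mono) auto
      ultimately have "1 \<le> ln (real q)" by linarith
      then have "3 * 1 + ln (3 / 4 * 1) \<le> Y" by (intro Ylow) auto
      moreover have "- ln (3 / 4 :: real) \<le> 4 / 3 - 1"
        using ln_le_minus_one[of "4 / 3 :: real"] by (simp add: ln_div)
      ultimately have "8 / 3 \<le> Y" by simp
      then show ?thesis using q by auto
    next
      assume q: "q \<in> {5, 6, 7}"
      have "3 / 2 \<le> ln (5::real)"
        by (intro ln_ge_of_pow_le) (simp_all add: power2_eq_square power_divide)
      moreover have "ln 5 \<le> ln (real q)" using q by (intro ln_mono) auto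
      ultimately have "3 / 2 \<le> ln (real q)" by linarith
      then have "3 * (3/2) + ln (3 / 4 * (3/2)) \<le> Y" by (intro Ylow) auto
      moreover have "0 \<le> ln (3 / 4 * (3/2) :: real)" by simp
      ultimately have "9 / 2 \<le> Y" by linarith
      then show ?thesis using q by (auto simp: power2_eq_square)
    next
      assume q: "q = 8"
      have "2 \<le> ln (8::real)"
        by (intro ln_ge_of_pow_le) (simp_all add: power2_eq_square power_divide)
      then have "3 * 2 + ln (3 / 4 * 2) \<le> Y" using q by (intro Ylow) auto
      moreover have "0 \<le> ln (3 / 4 * 2 :: real)" by simp
      ultimately have "6 \<le> Y" by linarith
      then show ?thesis using q by (simp add: power2_eq_square)
    qed
    then have "real q - 1 \<le> sqrt ((real q + 1) * Y)" by (rule real_le_rsqrt)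
    then show ?thesis using T0 by linarith
  next
    assume q: "q \<in> {9..12}"
    \<comment> \<open>The tangent at 4 and \<open>ln 4 <= 7/4\<close> give
      \<open>3 * ln q <= 3/4 * q + 9/4\<close>, which is at most \<open>q\<close> from 9 on.\<close>
    have "ln (real q / 4) \<le> real q / 4 - 1" using q by (intro ln_le_minus_one) auto
    moreover have "ln (real q / 4) = ln (real q) - ln 4" using q by (simp add: ln_div)
    moreover have "ln 4 \<le> (7 / 4 :: real)" by (intro ln_le_of_le_pow) (simp_all add: power_divide)
    moreover have "9 \<le> real q" using q by simp
    ultimately have "3 * ln (real q) \<le> real q" by linarith
    moreover have "ln (real q) > 0" using q by simp
    ultimately have "1 \<le> real q / (3 * ln (real q))" by simp
    then have T1: "T \<ge> 1" unfolding T_def by simp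
    have "q \<in> {9, 10} \<or> q = 11 \<or> q = 12" using q by auto
    then have "(real q - 2)\<^sup>2 \<le> (real q + 1) * Y"
    proof (elim disjE)
      assume q: "q \<in> {9, 10}"
      have "2 \<le> ln (8::real)"
        by (intro ln_ge_of_pow_le) (simp_all add: power2_eq_square power_divide)
      moreover have "ln 8 \<le> ln (real q)" using q by (intro ln_mono) auto
      ultimately have "2 \<le> ln (real q)" by linarith
      then have "3 * 2 + ln (3 / 4 * 2) \<le> Y" by (intro Ylow) auto
      moreover have "0 \<le> ln (3 / 4 * 2 :: real)" by simp
      ultimately have "6 \<le> Y" by linarith
      then show ?thesis using q by (auto simp: power2_eq_square)
    next
      assume q: "q = 11"
      have "23 / 10 \<le> ln (11::real)"
        by (intro ln_ge_of_pow_le) (simp_all add: power2_eq_square power_divide)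
      then have "3 * (23/10) + ln (3 / 4 * (23/10)) \<le> Y" using q by (intro Ylow) auto
      moreover have "0 \<le> ln (3 / 4 * (23/10) :: real)" by simp
      ultimately have "69 / 10 \<le> Y" by linarith
      then show ?thesis using q by (simp add: power2_eq_square)
    next
      assume q: "q = 12"
      have "12 / 5 \<le> ln (12::real)"
        by (intro ln_ge_of_pow_le) (simp_all add: power2_eq_square power_divide)
      then have "3 * (12/5) + ln (3 / 4 * (12/5)) \<le> Y" using q by (intro Ylow) auto
      \<comment> \<open>The bound 0 would be too weak here: 13 times 7.2 is 93.6, below the required
        100, while 13 times 7.7 is 100.1.\<close>
      moreover have "1 / 2 \<le> ln (3 / 4 * (12/5) :: real)"
       
        by (intro ln_ge_of_pow_le) (simp_all add: power2_eq_square power_divide)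
      ultimately have "77 / 10 \<le> Y" by linarith
      then show ?thesis using q by (simp add: power2_eq_square)
    qed
    then have "real q - 2 \<le> sqrt ((real q + 1) * Y)" by (rule real_le_rsqrt)
    then show ?thesis using T1 by linarith
  qed
  then show ?thesis unfolding Yeq T_def by linarith
qed

section \<open>Choosing the size of the greedy set\<close>

theorem theorem1:
  fixes P :: "'a set" and L :: "'a set set" and q :: nat
  assumes "q \<ge> 2"
    and "projective_plane_of_order P L q"
  shows "real (smallest_saturating_size P L)
    \<le> sqrt ((real q + 1) * (3 * ln (real q) + ln (ln (real q)) + ln (3 / 4)))
      + sqrt (real q / (3 * ln (real q))) + 3"
proof -
  interpret projective_plane_of_order P L q by (rule assms(2))
  show ?thesis
  proof (cases "q \<le> 12")
    case True
    have "real (smallest_saturating_size P L) \<le> real q + 2"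
      using smallest_saturating_size_le_line by linarith
    then show ?thesis using bound_ge_line[OF assms(1) True] by linarith
  next
    case False
    define x Y X where "x = real q" and "Y = 3 * ln x + ln (ln x) + ln (3 / 4)"
      and "X = sqrt ((x + 1) * Y)"
    have x13: "x \<ge> 13" using False by (simp add: x_def)
    have Y: "4 \<le> Y" "Y + 4 \<le> x" using exponent_bounds[OF x13] by (simp_all add: Y_def)
    have lnpos: "ln x > 0" using x13 by simp
    have X2: "X\<^sup>2 = (x + 1) * Y" unfolding X_def using Y x13 by simp
    have "(Y + 2)\<^sup>2 \<le> (x + 1) * Y"
    proof -
      have "(Y + 4) * Y \<le> x * Y" using Y by (intro mult_right_mono) auto
      then show ?thesis using Y by (simp add: power2_eq_square algebra_simps)
    qed
    then have XY: "Y + 2 \<le> X" unfolding X_def by (rule real_le_rsqrt)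
    \<comment> \<open>Large enough that \<open>(w - 2) * (w + 1)\<close> reaches
      \<open>(X - 1) * (X + 2)\<close>, yet below \<open>X + 2\<close>, so that the 1/2 from pairing
      fits into the final 3.\<close>
    define w where "w = nat \<lceil>X + 1\<rceil>"
    define r where "r = x\<^sup>2 * exp (- ((real w - 2) * (real w + 1)) / (2 * (x + 2)))"
    have w: "X + 1 \<le> w" "w < X + 2" unfolding w_def using XY Y by linarith+
    \<comment> \<open>The right side is \<open>X\<^sup>2 + X - 2 = (x + 1) * Y + (X - 2)\<close>,
      and \<open>XY\<close> supplies the missing \<open>Y\<close>.\<close>
    have "(x + 2) * Y \<le> (X - 1) * (X + 2)"
      using X2 XY by (simp add: power2_eq_square algebra_simps)
    also have "\<dots> \<le> (real w - 2) * (real w + 1)" using w XY Y by (intro mult_mono) auto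
    finally have "Y / 2 \<le> (real w - 2) * (real w + 1) / (2 * (x + 2))"
      using x13 by (simp add: field_simps)
    then have "r \<le> x\<^sup>2 * exp (- (Y / 2))"
      unfolding r_def by (intro mult_left_mono) auto
    \<comment> \<open>The logarithmic terms of \<open>Y\<close> give
      \<open>exp Y = 3/4 * x^3 * ln x\<close>, so half of this bound on the uncovered points is
      exactly the second root.\<close>
    also have "\<dots> = 2 * sqrt (x / (3 * ln x))"
    proof (rule power2_eq_imp_eq)
      have "exp Y = x ^ 3 * ln x * (3 / 4)"
      proof -
        have "exp (3 * ln x) = x ^ 3" using x13 exp_of_nat_mult[of 3 "ln x"] by simp
        then show ?thesis unfolding Y_def using lnpos by (simp add: exp_add)
      qed
      moreover have "(exp (- (Y / 2)))\<^sup>2 = 1 / exp Y"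
        using exp_double[of "- (Y / 2)"] by (simp add: exp_minus inverse_eq_divide)
      ultimately have "(x\<^sup>2 * exp (- (Y / 2)))\<^sup>2 = (x\<^sup>2)\<^sup>2 / (x ^ 3 * ln x * (3 / 4))"
        by (simp only: power_mult_distrib times_divide_eq_right mult_1_right)
      also have "\<dots> = 4 * (x / (3 * ln x))"
        using x13 lnpos by (simp add: divide_simps power2_eq_square power3_eq_cube)
      also have "\<dots> = (2 * sqrt (x / (3 * ln x)))\<^sup>2"
        using x13 lnpos by (simp add: power_mult_distrib)
      finally show "(x\<^sup>2 * exp (- (Y / 2)))\<^sup>2 = (2 * sqrt (x / (3 * ln x)))\<^sup>2" .
    qed (use x13 lnpos in auto)
    finally have "r \<le> 2 * sqrt (x / (3 * ln x))" .
    moreover have w2: "2 \<le> w" using w XY Y by linarith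
    ultimately have "real (smallest_saturating_size P L) \<le> X + sqrt (x / (3 * ln x)) + 3"
      using smallest_saturating_size_le_greedy[OF assms(1) w2, folded x_def, folded r_def] w(2)
      by argo
    then show ?thesis unfolding X_def Y_def x_def .
  qed
qed

end
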